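(* Let $\psi:\mathbb{R}\to\mathbb{R}$ be convex and differentiable with $$\int_{\mathbb{R}}e^{-\psi(z)}\mathrm{d}z=1,\quad\int_{\mathbb{R}}z\,e^{-\psi(z)}\mathrm{d}z=0,\quad\int_{\mathbb{R}}z^2e^{-\psi(z)}\mathrm{d}z=1.$$ Let $\sigma>0$, let the source model be the exponential location model with density $$u(x;\theta)=e^{-(x-\theta+1)}\ \text{ for }x\ge\theta-1,\qquad u(x;\theta)=0\ \text{ for }x<\theta-1,$$ and the target model be $v(y;\theta)=\frac1\sigma\exp\{-\psi(\frac{y-\theta}{\sigma})\}$. Let $$\mathcal{S}^*(y|x)=v(y;x+1)-\nabla_\theta v(y;\theta)\big|_{\theta=x+1},\qquad \mathcal{P}(y|x)=\frac{1}{2\sigma}\exp\Big\{-\psi\Big(\frac{y-x-1}{2\sigma}\Big)\Big\}.$$ Then for each $\theta\in\mathbb{R}$, with $X_\theta\sim u(\cdot;\theta)$, Algorithm $\textsc{rk}$ using $\mathcal{S}^*$ and $\mathcal{P}$, with any $y_0\in\mathbb{R}$, $N\ge1$ and any real $$M\ge2\exp\Big\{\frac{\psi(0)}{2}\Big\}\cdot\sup_{z\le\kappa(\sigma)}\exp\Big\{-\frac{\psi(z)}{2}\Big\}\Big(1-\frac{\psi'(z)}{\sigma}\Big),$$ satisfies $$\big\|\mathcal{L}[\textsc{rk}(X_\theta,N,M,y_0)]-v(\cdot;\theta)\big\|_{\mathsf{TV}}\le2\exp\Big\{-\frac NM\big(1-\tau(\sigma)\big)\Big\}+\tau(\sigm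a).$$
   Context: Define $\kappa(\sigma)=\inf\{z\in\mathbb{R}:\psi'(z)=\sigma\}$ if there is $z\in\mathbb{R}$ with $\psi'(z)=\sigma$, and $\kappa(\sigma)=+\infty$ otherwise; and $$\tau(\sigma)=2\int_{\kappa(\sigma)}^{+\infty}e^{-\psi(z)}\mathrm{d}z+\frac2\sigma e^{-\psi(\kappa(\sigma))},$$ with $\tau(\sigma)=0$ when $\kappa(\sigma)=+\infty$ (in that case the supremum in the condition on $M$ is over all $z\in\mathbb{R}$). Algorithm $\textsc{rk}(x,N,M,y_0)$ with kernel $\mathcal{S}^*$ and base densities $\mathcal{P}$: set $t=0$, $Y=y_0$, marked "unset". Repeat until $Y$ is set or $t\ge N+1$: draw $U_t\sim\mathsf{Unif}([0,1])$ and $Y_t\sim\mathcal{P}(\cdot|x)$, independent of each other and of the past; if $U_t\le\frac{\mathcal{S}^*(Y_t|x)\vee0}{M\,\mathcal{P}(Y_t|x)}$, set $Y\leftarrow Y_t$; then $t\leftarrow t+1$. Output $Y$. On a random input $X_\theta$, it is run with $x=X_\theta$ and fresh independent randomness. $\mathcal{L}[\cdot]$ denotes the law and $\|\cdot\|_{\mathsf{TV}}$ total variation distance. *)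

theory Defs
  imports "HOL-Probability.Probability"
begin

definition source_density :: "real \<Rightarrow> real \<Rightarrow> real" where
  "source_density x \<theta> = (if x \<ge> \<theta> - 1 then exp (- (x - \<theta> + 1)) else 0)"

definition target_density :: "(real \<Rightarrow> real) \<Rightarrow> real \<Rightarrow> real \<Rightarrow> real \<Rightarrow> real" where
  "target_density \<psi> \<sigma> y \<theta> = 1 / \<sigma> * exp (- \<psi> ((y - \<theta>) / \<sigma>))"

definition signed_kernel :: "(real \<Rightarrow> real) \<Rightarrow> real \<Rightarrow> real \<Rightarrow> real \<Rightarrow> real" where
  "signed_kernel \<psi> \<sigma> y x =
     target_density \<psi> \<sigma> y (x + 1) - deriv (\<lambda>\<theta>. target_density \<psi> \<sigma> y \<theta>) (x + 1)"

definition base_density :: "(real \<Rightarrow> real) \<Rightarrow> real \<Rightarrow> real \<Rightarrow> real \<Rightarrow> real" where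
  "base_density \<psi> \<sigma> y x = 1 / (2 * \<sigma>) * exp (- \<psi> ((y - x - 1) / (2 * \<sigma>)))"

definition kappa :: "(real \<Rightarrow> real) \<Rightarrow> real \<Rightarrow> ereal" where
  "kappa \<psi> \<sigma> = (if \<exists>z. deriv \<psi> z = \<sigma> then (INF z\<in>{z. deriv \<psi> z = \<sigma>}. ereal z) else \<infinity>)"

definition tau :: "(real \<Rightarrow> real) \<Rightarrow> real \<Rightarrow> real" where
  "tau \<psi> \<sigma> =
     (if kappa \<psi> \<sigma> = \<infinity> then 0
      else 2 * (LBINT z=kappa \<psi> \<sigma>..\<infinity>. exp (- \<psi> z))
           + 2 / \<sigma> * exp (- \<psi> (real_of_ereal (kappa \<psi> \<sigma>))))"

text \<open>
  The rejection sampler as a probabilistic program in the Giry monad. In the functions below a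
  kernel or conditional density \<open>K(y|x)\<close> is written \<open>K y x\<close>. The first numeric argument of
  \<open>rk_loop\<close> is the number of rounds that remain. Since \<open>t\<close> runs through \<open>0, ..., N\<close>,
  the sampler starts with \<open>N + 1\<close> rounds; the initial value \<open>y0\<close> is returned if no round accepts.
\<close>

definition rk_draw :: "(real \<Rightarrow> real \<Rightarrow> real) \<Rightarrow> real \<Rightarrow> (real \<times> real) measure" where
  "rk_draw P x = uniform_measure lborel {0..1} \<Otimes>\<^sub>M density lborel (\<lambda>y. ennreal (P y x))"

primrec rk_loop ::
  "(real \<Rightarrow> real \<Rightarrow> real) \<Rightarrow> (real \<Rightarrow> real \<Rightarrow> real) \<Rightarrow> real \<Rightarrow> real \<Rightarrow> real \<Rightarrow> nat \<Rightarrow> real measure"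
where
  "rk_loop S P x M y0 0 = return borel y0"
| "rk_loop S P x M y0 (Suc n) =
     rk_draw P x \<bind>
       (\<lambda>(u, y). if u \<le> max (S y x) 0 / (M * P y x) then return borel y
                 else rk_loop S P x M y0 n)"

definition rk ::
  "(real \<Rightarrow> real \<Rightarrow> real) \<Rightarrow> (real \<Rightarrow> real \<Rightarrow> real) \<Rightarrow> real \<Rightarrow> nat \<Rightarrow> real \<Rightarrow> real \<Rightarrow> real measure"
where
  "rk S P x N M y0 = rk_loop S P x M y0 (N + 1)"

text \<open>
  Total variation distance is normalised as a supremum over events, that is, half the \<open>L1\<close>
  distance of the densities. It is meant for probability measures on the same sigma-algebra.
\<close>

definition tv_dist :: "'a measure \<Rightarrow> 'a measure \<Rightarrow> real" where
  "tv_dist \<mu> \<nu> = (SUP A\<in>sets \<mu>. \<bar>measure \<mu> A - measure \<nu> A\<bar>)"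

end

theory Submission imports Defs begin

text \<open>
  Write \<open>n\<close> for the mass of the negative part of \<open>S*(.|x)\<close>; by the location-scale structure it does
  not depend on \<open>x\<close>, and since \<open>S*(.|x)\<close> integrates to 1, its positive part has mass \<open>1 + n\<close>. Given
  \<open>x\<close>, each round accepts with probability \<open>(1 + n) / M\<close>, so the output is the mixture of the normalised
  positive part and the point mass at \<open>y0\<close>, the latter with weight \<open>(1 - (1 + n) / M)^(N + 1)\<close>.
  It follows that on every event the output law given \<open>x\<close> differs from the signed measure \<open>S*(.|x)\<close> by
  at most that weight plus \<open>n\<close>. Averaging \<open>S*(y|x)\<close> over the exponential source returns \<open>v(y;\<theta>)\<close> exactly:
  the integrand is the \<open>x\<close>-derivative of \<open>-exp(-(x - \<theta> + 1)) v(y;x+1)\<close>. Finally \<open>n \<le> \<tau>(\<sigma>)\<close>, because the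
  negative part is supported on \<open>z \<ge> \<kappa>(\<sigma>)\<close> and dominated there by \<open>\<psi>'(z) exp(-\<psi>(z)) / \<sigma>\<close>.
\<close>

section \<open>Calculus on the line: improper integrals, affine substitution, intermediate values of
  derivatives\<close>

lemma set_integral_FTC_atLeast:
  fixes F f :: "real \<Rightarrow> real"
  assumes deriv: "\<And>x. a \<le> x \<Longrightarrow> (F has_real_derivative f x) (at x)"
    and int: "set_integrable lborel {a..} f"
    and lim: "(F \<longlongrightarrow> 0) at_top"
  shows "(LINT x:{a..}|lborel. f x) = - F a"
proof (rule tendsto_unique[OF trivial_limit_at_top_linorder])
  show "((\<lambda>b. LINT x:{a..b}|lborel. f x) \<longlongrightarrow> (LINT x:{a..}|lborel. f x)) at_top"
    by (rule tendsto_set_lebesgue_integral_at_top[OF _ int]) simp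
  have eq: "(LINT x:{a..b}|lborel. f x) = F b - F a" if "a \<le> b" for b
  proof -
    have "set_integrable lborel {a..b} f"
      by (rule set_integrable_subset[OF int]) auto
    then have "(LINT x:{a..b}|lborel. f x) = integral {a..b} f"
      by (rule set_borel_integral_eq_integral)
    moreover have "(f has_integral (F b - F a)) {a..b}"
      using deriv that
      by (intro fundamental_theorem_of_calculus)
         (auto simp: has_real_derivative_iff_has_vector_derivative[symmetric]
               intro: has_field_derivative_at_within)
    ultimately show ?thesis
      by (simp add: integral_unique)
  qed
  have "((\<lambda>b. F b - F a) \<longlongrightarrow> 0 - F a) at_top"
    by (intro tendsto_intros lim)
  moreover have "eventually (\<lambda>b. F b - F a = (LINT x:{a..b}|lborel. f x)) at_top"
    using eventually_ge_at_top[of a] by eventually_elim (simp add: eq)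
  ultimately show "((\<lambda>b. LINT x:{a..b}|lborel. f x) \<longlongrightarrow> - F a) at_top"
    by (auto elim: Lim_transform_eventually)
qed

lemma has_bochner_integral_location_scale:
  fixes h :: "real \<Rightarrow> real"
  assumes "has_bochner_integral lborel h I" "0 < c"
  shows "has_bochner_integral lborel (\<lambda>y. h ((y - t) / c) / c) I"
proof -
  have "has_bochner_integral lborel (\<lambda>y. h (- t / c + (1 / c) * y)) (I /\<^sub>R \<bar>1 / c\<bar>)"
    using lborel_has_bochner_integral_real_affine_iff[of "1 / c" h I "- t / c"] assms by simp
  from has_bochner_integral_divide[OF this, of c] show ?thesis
    using \<open>0 < c\<close> by (simp add: diff_divide_distrib)
qed

text \<open>Darboux property: \<open>f x - c * x\<close> dips below its value at \<open>a\<close>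
  just to the right and below its value at \<open>b\<close> just to the left, so its minimum is
  interior. The argument works without continuity of \<open>f'\<close> and so applies to
  \<open>deriv \<psi>\<close> directly.\<close>

lemma deriv_attains_between:
  fixes f f' :: "real \<Rightarrow> real"
  assumes deriv: "\<And>x. (f has_real_derivative f' x) (at x)"
    and "a \<le> b" "f' a < c" "c < f' b"
  obtains z where "f' z = c"
proof -
  define g where "g x = f x - c * x" for x
  have g: "(g has_real_derivative (f' x - c)) (at x)" for x
    unfolding g_def by (auto intro!: derivative_eq_intros deriv)
  have "continuous_on {a..b} g"
    using g by (meson DERIV_isCont continuous_at_imp_continuous_on)
  then obtain z where z: "z \<in> {a..b}" "\<And>y. y \<in> {a..b} \<Longrightarrow> g z \<le> g y"
    using continuous_attains_inf[of "{a..b}" g] \<open>a \<le> b\<close> by auto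
  have "a < b" using assms(2-4) by (cases "a = b") auto
  have "z \<noteq> a"
  proof
    assume "z = a"
    obtain d where d: "d > 0" "\<And>h. 0 < h \<Longrightarrow> h < d \<Longrightarrow> g (a + h) < g a"
      using DERIV_neg_dec_right[OF g[of a]] assms(3) by auto
    define h where "h = min (d / 2) (b - a)"
    have "0 < h" "h < d" "a + h \<in> {a..b}"
      using d(1) \<open>a < b\<close> by (auto simp: h_def)
    then show False using d(2) z(2) \<open>z = a\<close> by (metis not_less)
  qed
  moreover have "z \<noteq> b"
  proof
    assume "z = b"
    obtain d where d: "d > 0" "\<And>h. 0 < h \<Longrightarrow> h < d \<Longrightarrow> g (b - h) < g b"
      using DERIV_pos_inc_left[OF g[of b]] assms(4) by auto
    define h where "h = min (d / 2) (b - a)"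
    have "0 < h" "h < d" "b - h \<in> {a..b}"
      using d(1) \<open>a < b\<close> by (auto simp: h_def)
    then show False using d(2) z(2) \<open>z = b\<close> by (metis not_less)
  qed
  ultimately have "a < z" "z < b" using z(1) by auto
  have "f' z - c = 0"
  proof (rule DERIV_local_min[OF g])
    show "0 < min (z - a) (b - z)" using \<open>a < z\<close> \<open>z < b\<close> by simp
    show "\<forall>y. \<bar>z - y\<bar> < min (z - a) (b - z) \<longrightarrow> g z \<le> g y"
      using z(2) by (auto simp: abs_if split: if_splits)
  qed
  then show thesis using that by simp
qed

section \<open>Log-concave densities: slopes, modes, tails\<close>

locale log_concave_density =
  fixes \<psi> :: "real \<Rightarrow> real"
  assumes convex: "convex_on UNIV \<psi>"
    and differentiable: "\<psi> differentiable_on UNIV"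
    and integral_1: "has_bochner_integral lborel (\<lambda>z. exp (- \<psi> z)) 1"
begin

abbreviation d :: "real \<Rightarrow> real" where "d \<equiv> deriv \<psi>"

lemma DERIV_\<psi>: "(\<psi> has_real_derivative d z) (at z)"
  using differentiable
  by (metis DERIV_deriv_iff_real_differentiable UNIV_I differentiable_on_def)

lemmas DERIV_\<psi>_chain [derivative_intros] = DERIV_chain2[OF DERIV_\<psi>]

lemma above_tangent: "\<psi> c + d c * (x - c) \<le> \<psi> x"
  using convex_on_imp_above_tangent[OF convex, of c x "d c"] DERIV_\<psi> by simp

lemma mono_d: "mono d"
proof (rule monoI)
  fix x y :: real assume "x \<le> y"
  \<comment> \<open>Adding the tangent inequalities at \<open>x\<close> and at \<open>y\<close>
    cancels the values of \<psi>.\<close>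
  have "(d x - d y) * (y - x) \<le> 0"
    using above_tangent[of x y] above_tangent[of y x] by (simp add: algebra_simps)
  then show "d x \<le> d y"
    using \<open>x \<le> y\<close> by (cases "x = y") (auto simp: mult_le_0_iff)
qed

lemma borel_measurable_\<psi> [measurable]: "\<psi> \<in> borel_measurable borel"
  using DERIV_\<psi>
  by (intro borel_measurable_continuous_onI) (meson DERIV_isCont continuous_at_imp_continuous_on)

lemma borel_measurable_d [measurable]: "d \<in> borel_measurable borel"
  by (rule borel_measurable_mono[OF mono_d])

lemma integrable_exp: "integrable lborel (\<lambda>z. exp (- \<psi> z))"
  using integral_1 by (rule integrable.intros)

text \<open>If no slope were positive, the tangent at any \<open>x \<ge> 0\<close> would force
  \<open>\<psi> x \<le> \<psi> 0\<close>; the density would stay above a positive constant on a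
  half-line and could not have mass 1.\<close>

lemma ex_d_pos: "\<exists>z. d z > 0"
proof (rule ccontr)
  assume "\<not> ?thesis"
  then have d: "d z \<le> 0" for z by (auto simp: not_less)
  have le: "\<psi> x \<le> \<psi> 0" if "0 \<le> x" for x
  proof -
    have "d x * (0 - x) \<ge> 0" using d[of x] that by (simp add: mult_nonpos_nonneg)
    then show ?thesis using above_tangent[of x 0] by linarith
  qed
  \<comment> \<open>The rectangle over \<open>{0..r}\<close> of height
    \<open>exp (- \<psi> 0)\<close> has area 2, more than the total mass.\<close>
  define r where "r = 2 * exp (\<psi> 0)"
  have "(\<integral>\<^sup>+x. ennreal (exp (- \<psi> 0)) * indicator {0..r} x \<partial>lborel) \<le> (\<integral>\<^sup>+x. exp (- \<psi> x) \<partial>lborel)"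
    by (rule nn_integral_mono) (auto split: split_indicator intro!: ennreal_leI le)
  also have "\<dots> = 1"
    using integral_1 by (simp add: nn_integral_eq_integral[OF integrable_exp] has_bochner_integral_integral_eq)
  also have "(\<integral>\<^sup>+x. ennreal (exp (- \<psi> 0)) * indicator {0..r} x \<partial>lborel) = 2"
    by (simp add: nn_integral_cmult_indicator r_def ennreal_mult[symmetric] exp_minus field_simps)
  finally show False by simp
qed

text \<open>Carries facts about the right half-line over to the left one.\<close>

lemma reflect: "log_concave_density (\<lambda>z. \<psi> (- z))"
proof
  show "convex_on UNIV (\<lambda>z. \<psi> (- z))"
  proof (rule convex_onI)
    fix t x y :: real assume "0 < t" "t < 1"
    then show "\<psi> (- ((1 - t) *\<^sub>R x + t *\<^sub>R y)) \<le> (1 - t) * \<psi> (- x) + t * \<psi> (- y)"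
      using convex_onD[OF convex, of t "- x" "- y"] by simp
  qed simp
  show "(\<lambda>z. \<psi> (- z)) differentiable_on UNIV"
    unfolding differentiable_on_def
    using DERIV_\<psi>_chain[OF DERIV_minus[OF DERIV_ident]]
    by (auto simp: real_differentiable_def)
  show "has_bochner_integral lborel (\<lambda>z. exp (- \<psi> (- z))) 1"
    using lborel_has_bochner_integral_real_affine_iff[of "- 1" "\<lambda>z. exp (- \<psi> z)" 1 0] integral_1
    by simp
qed

lemma deriv_reflect: "deriv (\<lambda>z. \<psi> (- z)) z = - d (- z)"
  by (rule DERIV_imp_deriv) (auto intro!: derivative_eq_intros)

lemma ex_d_neg: "\<exists>z. d z < 0"
  using log_concave_density.ex_d_pos[OF reflect] by (force simp: deriv_reflect)

text \<open>Slopes of both signs exist, so the Darboux property applies. Such a point is a mode of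
  the density; it later splits integrals and serves as a test point.\<close>

lemma ex_d_eq_0: "\<exists>z. d z = 0"
proof -
  obtain a b where "d a < 0" "0 < d b" using ex_d_pos ex_d_neg by auto
  moreover from this have "a \<le> b"
    using monoD[OF mono_d, of b a] by linarith
  ultimately show ?thesis
    using deriv_attains_between[OF DERIV_\<psi>, of a b 0] by blast
qed

lemma \<psi>_bounded_below: "\<exists>m. \<forall>x. \<psi> m \<le> \<psi> x"
proof -
  obtain m where "d m = 0" using ex_d_eq_0 by auto
  then show ?thesis using above_tangent[of m] by auto
qed

text \<open>A tangent of positive slope is an affine minorant of \<psi> that tends to
  infinity.\<close>

lemma tendsto_exp_at_top: "((\<lambda>z. exp (- \<psi> z)) \<longlongrightarrow> 0) at_top"
proof -
  obtain b where b: "d b > 0" using ex_d_pos by auto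
  have "filterlim (\<lambda>x. (\<psi> b - d b * b) + d b * x) at_top at_top"
    using b by (intro filterlim_tendsto_add_at_top[OF tendsto_const]
       filterlim_tendsto_pos_mult_at_top[OF tendsto_const]) (auto simp: filterlim_ident)
  then have "filterlim \<psi> at_top at_top"
    by (rule filterlim_at_top_mono) (use above_tangent[of b] in \<open>auto simp: algebra_simps\<close>)
  then show ?thesis
    by (intro filterlim_compose[OF exp_at_bot] filterlim_compose[OF filterlim_uminus_at_bot_at_top])
qed

text \<open>Monotonicity of \<open>d\<close> makes the integrand nonnegative on the half-line. As it
  is the derivative of \<open>- exp (- \<psi> z)\<close>, its nonnegative integral equals a finite
  boundary term.\<close>

lemma set_integrable_d_exp_atLeast:
  assumes "d a \<ge> 0"
  shows "set_integrable lborel {a..} (\<lambda>z. d z * exp (- \<psi> z))"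
proof -
  have nn: "(\<integral>\<^sup>+x. ennreal (d x * exp (- \<psi> x)) * indicator {a..} x \<partial>lborel) = 0 - (- exp (- \<psi> a))"
  proof (rule nn_integral_FTC_atLeast)
    show "((\<lambda>x. - exp (- \<psi> x)) has_real_derivative d x * exp (- \<psi> x)) (at x)" for x
      by (auto intro!: derivative_eq_intros)
    show "0 \<le> d x * exp (- \<psi> x)" if "a \<le> x" for x
      using monoD[OF mono_d that] assms by simp
    show "((\<lambda>x. - exp (- \<psi> x)) \<longlongrightarrow> 0) at_top"
      using tendsto_minus[OF tendsto_exp_at_top] by simp
  qed simp
  have nonneg: "0 \<le> d x" if "a \<le> x" for x
    using monoD[OF mono_d that] assms by simp
  show ?thesis
    unfolding set_integrable_def
  proof (rule integrableI_nonneg)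
    have "(\<integral>\<^sup>+x. ennreal (indicator {a..} x *\<^sub>R (d x * exp (- \<psi> x))) \<partial>lborel)
        = (\<integral>\<^sup>+x. ennreal (d x * exp (- \<psi> x)) * indicator {a..} x \<partial>lborel)"
      by (intro nn_integral_cong) (auto split: split_indicator)
    then show "(\<integral>\<^sup>+x. ennreal (indicator {a..} x *\<^sub>R (d x * exp (- \<psi> x))) \<partial>lborel) < \<infinity>"
      by (simp add: nn)
  qed (use nonneg in \<open>auto split: split_indicator\<close>)
qed

lemma set_integral_d_exp_atLeast:
  assumes "d a \<ge> 0"
  shows "(LINT z:{a..}|lborel. d z * exp (- \<psi> z)) = exp (- \<psi> a)"
proof -
  have "(LINT z:{a..}|lborel. d z * exp (- \<psi> z)) = - (- exp (- \<psi> a))"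
  proof (rule set_integral_FTC_atLeast)
    show "((\<lambda>x. - exp (- \<psi> x)) has_real_derivative d x * exp (- \<psi> x)) (at x)" for x
      by (auto intro!: derivative_eq_intros)
    show "((\<lambda>x. - exp (- \<psi> x)) \<longlongrightarrow> 0) at_top"
      using tendsto_minus[OF tendsto_exp_at_top] by simp
  qed (rule set_integrable_d_exp_atLeast[OF assms])
  then show ?thesis by simp
qed

text \<open>Split at a mode \<open>m\<close>: the right half contributes
  \<open>exp (- \<psi> m)\<close>, and the left half, by reflection, the same amount with the
  opposite sign.\<close>

lemma has_bochner_integral_d_exp:
  "has_bochner_integral lborel (\<lambda>z. d z * exp (- \<psi> z)) 0"
proof -
  obtain m where m: "d m = 0" using ex_d_eq_0 by auto
  interpret R: log_concave_density "\<lambda>z. \<psi> (- z)" by (rule reflect)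
  let ?f = "\<lambda>z. d z * exp (- \<psi> z)"
  have right: "has_bochner_integral lborel (\<lambda>z. indicator {m..} z *\<^sub>R ?f z) (exp (- \<psi> m))"
    using set_integrable_d_exp_atLeast[of m] set_integral_d_exp_atLeast[of m] m
    by (simp add: has_bochner_integral_iff set_integrable_def set_lebesgue_integral_def)
  have Rm: "R.d (- m) \<ge> 0" by (simp add: deriv_reflect m)
  have "has_bochner_integral lborel
      (\<lambda>z. indicator {- m..} z *\<^sub>R (R.d z * exp (- \<psi> (- z)))) (exp (- \<psi> m))"
    using R.set_integrable_d_exp_atLeast[OF Rm] R.set_integral_d_exp_atLeast[OF Rm]
    by (simp add: has_bochner_integral_iff set_integrable_def set_lebesgue_integral_def)
  then have "has_bochner_integral lborel
      (\<lambda>z. indicator {- m..} (- z) *\<^sub>R (- d z * exp (- \<psi> z))) (exp (- \<psi> m))"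
    using lborel_has_bochner_integral_real_affine_iff[of "- 1"
        "\<lambda>z. indicator {- m..} z *\<^sub>R (R.d z * exp (- \<psi> (- z)))" "exp (- \<psi> m)" 0]
    by (simp add: deriv_reflect)
  from has_bochner_integral_diff[OF right this]
  \<comment> \<open>The two half-lines share the point \<open>m\<close>, where the integrand
    vanishes.\<close>
  show ?thesis
    by (rule has_bochner_integral_cong[THEN iffD1, rotated -1])
       (auto simp: m split: split_indicator)
qed

end

section \<open>Rejection sampling at a fixed input\<close>

lemma emeasure_uniform_Icc:
  assumes "0 \<le> r" "r \<le> 1"
  shows "emeasure (uniform_measure lborel {0..1::real}) {..r} = ennreal r"
    and "emeasure (uniform_measure lborel {0..1::real}) {r<..} = ennreal (1 - r)"
proof -
  have "{0..1} \<inter> {..r} = {0..r}" "{0..1} \<inter> {r<..} = {r<..1}"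
    using assms by auto
  then show "emeasure (uniform_measure lborel {0..1::real}) {..r} = ennreal r"
    and "emeasure (uniform_measure lborel {0..1::real}) {r<..} = ennreal (1 - r)"
    using assms by (simp_all add: divide_ennreal_def)
qed

text \<open>The input is frozen: \<open>s\<close> is the signed kernel and \<open>p\<close> the
  proposal density as functions of the output alone. The mass \<open>q\<close> of the positive part
  makes \<open>q / M\<close> the acceptance probability of a round.\<close>

locale rejection_sampler =
  fixes s p :: "real \<Rightarrow> real" and M q :: real
  assumes s_measurable [measurable]: "s \<in> borel_measurable borel"
    and p_nonneg: "\<And>y. 0 \<le> p y"
    and s_le: "\<And>y. max (s y) 0 \<le> M * p y"
    and integral_p: "has_bochner_integral lborel p 1"
    and integral_s: "has_bochner_integral lborel (\<lambda>y. max (s y) 0) q"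
    and q_pos: "0 < q"
begin

lemma p_measurable [measurable]: "p \<in> borel_measurable borel"
  using integral_p by (auto dest: integrable.intros)

lemma q_le_M: "q \<le> M"
proof -
  have p: "has_bochner_integral lborel (\<lambda>y. M * p y) (M * 1)"
    using integral_p by (intro has_bochner_integral_mult_right) auto
  have "(LINT y|lborel. max (s y) 0) \<le> (LINT y|lborel. M * p y)"
    by (rule integral_mono[OF integrable.intros[OF integral_s] integrable.intros[OF p] s_le])
  then show ?thesis
    unfolding has_bochner_integral_integral_eq[OF integral_s] has_bochner_integral_integral_eq[OF p]
    by simp
qed

lemma M_pos: "0 < M"
  using q_pos q_le_M by linarith

definition accept :: "real \<Rightarrow> real" where
  "accept y = max (s y) 0 / (M * p y)"

lemma accept_measurable [measurable]: "accept \<in> borel_measurable borel"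
  unfolding accept_def by measurable

lemma accept_bounds: "0 \<le> accept y" "accept y \<le> 1"
  using s_le[of y] p_nonneg[of y] M_pos
  by (auto simp: accept_def divide_le_eq_1 zero_less_mult_iff not_less)

text \<open>Where \<open>p y = 0\<close>, division by zero yields \<open>accept y = 0\<close>, and
  \<open>s_le\<close> forces the positive part of \<open>s\<close> to vanish too, so no exceptional
  points remain.\<close>

lemma p_accept: "p y * accept y = max (s y) 0 / M"
  using s_le[of y] M_pos by (cases "p y = 0") (auto simp: accept_def)

text \<open>\<open>accepted A / M\<close> is the probability that a round accepts a value in
  \<open>A\<close>; \<open>accepted A / q\<close> is the law of an accepted value.\<close>

definition accepted :: "real set \<Rightarrow> real" where
  "accepted A = (LINT y:A|lborel. max (s y) 0)"

lemma set_integrable_s: "A \<in> sets borel \<Longrightarrow> set_integrable lborel A (\<lambda>y. max (s y) 0)"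
  using integrable.intros[OF integral_s]
  unfolding set_integrable_def by (intro integrable_mult_indicator) auto

lemma accepted_nonneg: "0 \<le> accepted A"
  unfolding accepted_def set_lebesgue_integral_def by (intro integral_nonneg_AE) auto

lemma accepted_UNIV: "accepted UNIV = q"
  using has_bochner_integral_integral_eq[OF integral_s]
  by (simp add: accepted_def set_lebesgue_integral_def)

lemma accepted_le: "A \<in> sets borel \<Longrightarrow> accepted A \<le> q"
  using set_integrable_s[of A] integrable.intros[OF integral_s]
  unfolding accepted_UNIV[symmetric] accepted_def set_lebesgue_integral_def set_integrable_def
  by (intro integral_mono) (auto split: split_indicator)

abbreviation draw :: "(real \<times> real) measure" where
  "draw \<equiv> uniform_measure lborel {0..1} \<Otimes>\<^sub>M density lborel (\<lambda>y. ennreal (p y))"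

lemma prob_space_base: "prob_space (density lborel (\<lambda>y. ennreal (p y)))"
proof
  have "(\<integral>\<^sup>+y. ennreal (p y) \<partial>lborel) = 1"
    using integral_p p_nonneg
    by (subst nn_integral_eq_integral) (auto simp: has_bochner_integral_iff)
  then show "emeasure (density lborel (\<lambda>y. ennreal (p y))) (space (density lborel (\<lambda>y. ennreal (p y)))) = 1"
    by (simp add: emeasure_density)
qed

lemma prob_space_uniform: "prob_space (uniform_measure lborel {0..1::real})"
  by (rule prob_space_uniform_measure) auto

text \<open>Integrating out \<open>u\<close> first turns the test into the factor
  \<open>accept y\<close>, and \<open>p_accept\<close> then cancels the proposal density. The number
  \<open>l\<close> stands for the probability that the remaining rounds end in
  \<open>A\<close>.\<close>

lemma nn_integral_round:
  assumes [measurable]: "A \<in> sets borel" and "0 \<le> l"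
  shows "(\<integral>\<^sup>+(u, y). (if u \<le> accept y then indicator A y else ennreal l) \<partial>draw)
    = ennreal (accepted A / M + (1 - q / M) * l)"
proof -
  interpret U: prob_space "uniform_measure lborel {0..1::real}" by (rule prob_space_uniform)
  interpret P: prob_space "density lborel (\<lambda>y. ennreal (p y))" by (rule prob_space_base)
  interpret pair_sigma_finite "uniform_measure lborel {0..1::real}" "density lborel (\<lambda>y. ennreal (p y))" ..
  have inner: "(\<integral>\<^sup>+u. (if u \<le> accept y then indicator A y else ennreal l) \<partial>uniform_measure lborel {0..1})
      = ennreal (accept y * indicator A y + (1 - accept y) * l)" for y
  proof -
    have "(\<integral>\<^sup>+u. (if u \<le> accept y then indicator A y else ennreal l) \<partial>uniform_measure lborel {0..1})
       = (\<integral>\<^sup>+u. indicator A y * indicator {..accept y} u + ennreal l * indicator {accept y<..} u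
            \<partial>uniform_measure lborel {0..1})"
      by (intro nn_integral_cong) (auto split: split_indicator)
    also have "\<dots> = indicator A y * ennreal (accept y) + ennreal l * ennreal (1 - accept y)"
      using emeasure_uniform_Icc[OF accept_bounds, of y]
      by (subst nn_integral_add) (auto simp: nn_integral_cmult)
    also have "\<dots> = ennreal (accept y * indicator A y + (1 - accept y) * l)"
      using accept_bounds[of y] \<open>0 \<le> l\<close>
      by (auto simp: ennreal_mult[symmetric] ennreal_plus[symmetric] mult_ac split: split_indicator
               simp del: ennreal_plus)
    finally show ?thesis .
  qed
  have int_A: "integrable lborel (\<lambda>y. indicator A y * max (s y) 0)"
    using set_integrable_s[of A] by (simp add: set_integrable_def)
  have ip: "integrable lborel p" "integrable lborel (\<lambda>y. max (s y) 0)"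
    using integral_p integral_s by (auto dest: integrable.intros)
  have "(\<integral>\<^sup>+(u, y). (if u \<le> accept y then indicator A y else ennreal l) \<partial>draw)
      = (\<integral>\<^sup>+y. ennreal (accept y * indicator A y + (1 - accept y) * l) \<partial>density lborel (\<lambda>y. ennreal (p y)))"
    by (subst nn_integral_snd[symmetric]) (simp_all add: inner)
  also have "\<dots> = (\<integral>\<^sup>+y. ennreal (p y) * ennreal (accept y * indicator A y + (1 - accept y) * l) \<partial>lborel)"
    by (subst nn_integral_density) auto
  also have "\<dots> = (\<integral>\<^sup>+y. ennreal (indicator A y * max (s y) 0 / M + (p y - max (s y) 0 / M) * l) \<partial>lborel)"
  proof (rule nn_integral_cong)
    fix y
    have "p y * (accept y * indicator A y + (1 - accept y) * l)
        = p y * accept y * indicator A y + (p y - p y * accept y) * l"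
      by (simp add: algebra_simps)
    then show "ennreal (p y) * ennreal (accept y * indicator A y + (1 - accept y) * l)
        = ennreal (indicator A y * max (s y) 0 / M + (p y - max (s y) 0 / M) * l)"
      by (simp add: ennreal_mult'[symmetric] p_nonneg p_accept mult.commute)
  qed
  also have "\<dots> = ennreal (LINT y|lborel. indicator A y * max (s y) 0 / M + (p y - max (s y) 0 / M) * l)"
  proof (rule nn_integral_eq_integral)
    show "AE y in lborel. 0 \<le> indicator A y * max (s y) 0 / M + (p y - max (s y) 0 / M) * l"
    proof (rule AE_I2)
      fix y
      have "max (s y) 0 / M \<le> p y" using s_le[of y] M_pos by (simp add: field_simps)
      then show "0 \<le> indicator A y * max (s y) 0 / M + (p y - max (s y) 0 / M) * l"
        using \<open>0 \<le> l\<close> M_pos by (intro add_nonneg_nonneg mult_nonneg_nonneg divide_nonneg_pos) auto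
    qed
  qed (use int_A ip in auto)
  also have "(LINT y|lborel. indicator A y * max (s y) 0 / M + (p y - max (s y) 0 / M) * l)
      = accepted A / M + (1 - q / M) * l"
    using int_A ip has_bochner_integral_integral_eq[OF integral_p] has_bochner_integral_integral_eq[OF integral_s]
    by (simp add: accepted_def set_lebesgue_integral_def)
  finally show ?thesis .
qed

text \<open>\<open>(1 - q / M) ^ n\<close> is the probability that all \<open>n\<close> rounds
  reject. Having a closed form lets both the error bound and measurability in the input be read
  off.\<close>

definition output_prob :: "real \<Rightarrow> nat \<Rightarrow> real set \<Rightarrow> real" where
  "output_prob y0 n A = (1 - (1 - q / M) ^ n) * (accepted A / q) + (1 - q / M) ^ n * indicator A y0"

lemma reject_bounds: "0 \<le> 1 - q / M" "1 - q / M \<le> 1"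
  using q_pos q_le_M M_pos by auto

lemma output_prob_nonneg: "0 \<le> output_prob y0 n A"
  unfolding output_prob_def using reject_bounds accepted_nonneg[of A] q_pos
  by (intro add_nonneg_nonneg mult_nonneg_nonneg) (auto simp: power_le_one)

lemma output_prob_Suc: "output_prob y0 (Suc n) A = accepted A / M + (1 - q / M) * output_prob y0 n A"
  using q_pos M_pos unfolding output_prob_def by (simp add: field_simps)

text \<open>With \<open>a\<close> the conditional probability of \<open>A\<close> given acceptance
  and \<open>e\<close> the negative mass inside \<open>A\<close>, the difference is
  \<open>r * (indicator A y0 - a) + (e - (q - 1) * a)\<close>. Both \<open>e\<close> and
  \<open>(q - 1) * a\<close> lie in \<open>[0, q - 1]\<close>, so their difference costs
  \<open>q - 1\<close> only once.\<close>

lemma output_prob_error: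
  assumes s: "has_bochner_integral lborel s 1" and A [measurable]: "A \<in> sets borel"
  shows "\<bar>output_prob y0 n A - (LINT y:A|lborel. s y)\<bar> \<le> (1 - q / M) ^ n + (q - 1)"
proof -
  have int: "integrable lborel s" "integrable lborel (\<lambda>y. max (s y) 0)"
    using s integral_s by (auto dest: integrable.intros)
  have neg: "integrable lborel (\<lambda>y. max (s y) 0 - s y)"
    using int by auto
  define e where "e = (LINT y:A|lborel. max (s y) 0 - s y)"
  have "0 \<le> e"
    unfolding e_def set_lebesgue_integral_def
    by (intro integral_nonneg_AE AE_I2) (auto split: split_indicator)
  have "e \<le> (LINT y|lborel. max (s y) 0 - s y)"
    unfolding e_def set_lebesgue_integral_def
  proof (rule integral_mono)
    show "integrable lborel (\<lambda>y. indicator A y *\<^sub>R (max (s y) 0 - s y))"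
      using neg by (intro integrable_mult_indicator) auto
  qed (use neg in \<open>auto split: split_indicator\<close>)
  also have "\<dots> = q - 1"
    using int has_bochner_integral_integral_eq[OF s] has_bochner_integral_integral_eq[OF integral_s]
    by simp
  finally have "e \<le> q - 1" .
  have "set_integrable lborel A s"
    unfolding set_integrable_def using int by (intro integrable_mult_indicator) auto
  then have e_eq: "e = accepted A - (LINT y:A|lborel. s y)"
    unfolding e_def accepted_def using set_integrable_s[OF A] by (intro set_integral_diff)
  define a r where "a = accepted A / q" and "r = (1 - q / M) ^ n"
  have "(LINT y:A|lborel. s y) = q * a - e"
    using e_eq q_pos by (simp add: a_def)
  then have eq: "output_prob y0 n A - (LINT y:A|lborel. s y)
      = r * (indicator A y0 - a) + (e - (q - 1) * a)"
    unfolding output_prob_def a_def[symmetric] r_def[symmetric] by (simp add: algebra_simps)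
  have a: "0 \<le> a" "a \<le> 1"
    using accepted_nonneg[of A] accepted_le[OF A] q_pos by (auto simp: a_def)
  have "0 \<le> (q - 1) * a" "(q - 1) * a \<le> q - 1"
    using a \<open>0 \<le> e\<close> \<open>e \<le> q - 1\<close> by (auto intro: mult_left_le)
  then have "\<bar>e - (q - 1) * a\<bar> \<le> q - 1"
    using \<open>0 \<le> e\<close> \<open>e \<le> q - 1\<close> by linarith
  moreover have "\<bar>r * (indicator A y0 - a)\<bar> \<le> r"
    using reject_bounds a unfolding abs_mult r_def
    by (intro order_trans[OF mult_left_le]) (auto split: split_indicator)
  ultimately show ?thesis
    unfolding eq r_def by linarith
qed

end

text \<open>Induction on the remaining rounds; the tail of the loop does not depend on the current
  draw. The probability-space and sigma-algebra claims are carried along because the continuation of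
  the bind must lie in \<open>subprob_algebra borel\<close>.\<close>

lemma rejection_loop:
  assumes "rejection_sampler (\<lambda>y. S y x) (\<lambda>y. P y x) M q"
  shows "prob_space (rk_loop S P x M y0 n) \<and> sets (rk_loop S P x M y0 n) = sets borel \<and>
    (\<forall>A\<in>sets borel. emeasure (rk_loop S P x M y0 n) A =
      ennreal (rejection_sampler.output_prob (\<lambda>y. S y x) M q y0 n A))"
proof (induction n)
  interpret rejection_sampler "\<lambda>y. S y x" "\<lambda>y. P y x" M q by fact
  case 0
  show ?case
    by (auto simp: prob_space_return output_prob_def split: split_indicator)
next
  interpret rejection_sampler "\<lambda>y. S y x" "\<lambda>y. P y x" M q by fact
  case (Suc n)
  let ?L = "rk_loop S P x M y0 n"
  interpret L: prob_space ?L using Suc by simp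
  interpret U: prob_space "uniform_measure lborel {0..1::real}" by (rule prob_space_uniform)
  interpret P: prob_space "density lborel (\<lambda>y. ennreal (P y x))" by (rule prob_space_base)
  interpret D: pair_prob_space "uniform_measure lborel {0..1::real}" "density lborel (\<lambda>y. ennreal (P y x))" ..
  have sets_L: "sets ?L = sets borel" using Suc by simp
  have L: "?L \<in> space (subprob_algebra borel)"
    using sets_L L.subprob_space_axioms by (simp add: space_subprob_algebra)
  let ?k = "\<lambda>(u, y). if u \<le> accept y then return borel y else ?L"
  have k: "?k \<in> measurable draw (subprob_algebra borel)"
    using L by measurable
  have eq: "rk_loop S P x M y0 (Suc n) = draw \<bind> ?k"
    by (simp add: rk_draw_def accept_def)
  have ne: "space draw \<noteq> {}" by (rule D.not_empty)
  have "emeasure (draw \<bind> ?k) A = ennreal (output_prob y0 (Suc n) A)" if A: "A \<in> sets borel" for A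
  proof -
    have "emeasure (draw \<bind> ?k) A = (\<integral>\<^sup>+z. emeasure (?k z) A \<partial>draw)"
      by (rule emeasure_bind[OF ne k A])
    \<comment> \<open>The induction hypothesis replaces the tail by its closed form, so that
      \<open>nn_integral_round\<close> applies with \<open>l = output_prob y0 n A\<close>.\<close>
    also have "\<dots> = (\<integral>\<^sup>+(u, y). (if u \<le> accept y then indicator A y else ennreal (output_prob y0 n A)) \<partial>draw)"
      using A Suc by (intro nn_integral_cong) auto
    finally show ?thesis
      using A by (simp add: nn_integral_round output_prob_nonneg output_prob_Suc)
  qed
  moreover have "prob_space (draw \<bind> ?k)"
    by (rule D.prob_space_bind[OF _ k])
       (auto simp: prob_space_return L.prob_space_axioms)
  moreover have "sets (draw \<bind> ?k) = sets borel"
    by (rule sets_bind_measurable[OF k ne])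
  ultimately show ?case
    unfolding eq by blast
qed

section \<open>Source law, and the signed kernel in standard coordinates\<close>

lemma prob_space_source_density: "prob_space (density lborel (\<lambda>x. ennreal (source_density x \<theta>)))"
proof
  have "(\<integral>\<^sup>+x. ennreal (source_density x \<theta>) \<partial>lborel)
      = (\<integral>\<^sup>+x. ennreal (exp (- (x - \<theta> + 1))) * indicator {\<theta> - 1..} x \<partial>lborel)"
    by (intro nn_integral_cong) (auto simp: source_density_def split: split_indicator)
  also have "\<dots> = ennreal (0 - (- exp (- (\<theta> - 1 - \<theta> + 1))))"
  proof (rule nn_integral_FTC_atLeast)
    show "((\<lambda>x. - exp (- (x - \<theta> + 1))) has_real_derivative exp (- (x - \<theta> + 1))) (at x)" for x
      by (auto intro!: derivative_eq_intros)
    show "((\<lambda>x. - exp (- (x - \<theta> + 1))) \<longlongrightarrow> 0) at_top"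
      by real_asymp
  qed auto
  finally show "emeasure (density lborel (\<lambda>x. ennreal (source_density x \<theta>)))
      (space (density lborel (\<lambda>x. ennreal (source_density x \<theta>)))) = 1"
    by (simp add: emeasure_density source_density_def)
qed

locale exponential_location_model = log_concave_density +
  fixes \<sigma> :: real
  assumes \<sigma>_pos: "0 < \<sigma>"
begin

text \<open>The signed kernel in the coordinate \<open>z = (y - (x + 1)) / \<sigma>\<close>, up to
  the factor \<open>1 / \<sigma>\<close>.\<close>

definition g :: "real \<Rightarrow> real" where
  "g z = exp (- \<psi> z) * (1 - d z / \<sigma>)"

lemma g_measurable [measurable]: "g \<in> borel_measurable borel"
  unfolding g_def by measurable

text \<open>The minus sign in front of \<psi> and the one from the inner map cancel in the
  \<theta>-derivative, hence the factor \<open>1 - d z / \<sigma>\<close> in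
  \<open>g\<close>.\<close>

lemma signed_kernel_eq: "signed_kernel \<psi> \<sigma> y x = g ((y - (x + 1)) / \<sigma>) / \<sigma>"
proof -
  have "((\<lambda>\<theta>. target_density \<psi> \<sigma> y \<theta>) has_real_derivative
      1 / \<sigma> * (exp (- \<psi> ((y - (x + 1)) / \<sigma>)) * (d ((y - (x + 1)) / \<sigma>) / \<sigma>))) (at (x + 1))"
    unfolding target_density_def using \<sigma>_pos by (auto intro!: derivative_eq_intros)
  from DERIV_imp_deriv[OF this] show ?thesis
    by (simp add: signed_kernel_def target_density_def g_def algebra_simps diff_divide_distrib)
qed

lemma signed_kernel_measurable [measurable]:
  "(\<lambda>(x, y). signed_kernel \<psi> \<sigma> y x) \<in> borel_measurable (borel \<Otimes>\<^sub>M borel)"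
  unfolding signed_kernel_eq by measurable

lemma base_density_eq: "base_density \<psi> \<sigma> y x = exp (- \<psi> ((y - (x + 1)) / (2 * \<sigma>))) / (2 * \<sigma>)"
  by (simp add: base_density_def diff_diff_eq)

lemma has_bochner_integral_g: "has_bochner_integral lborel g 1"
proof -
  have "has_bochner_integral lborel (\<lambda>z. exp (- \<psi> z) - d z * exp (- \<psi> z) / \<sigma>) (1 - 0 / \<sigma>)"
    by (intro has_bochner_integral_diff has_bochner_integral_divide integral_1 has_bochner_integral_d_exp)
  then show ?thesis
    unfolding g_def by (simp add: algebra_simps)
qed

lemma integrable_g: "integrable lborel g"
  using has_bochner_integral_g by (rule integrable.intros)

section \<open>The negative mass and the threshold \<open>kappa\<close>\<close>

definition negative_mass :: real where
  "negative_mass = (LINT z|lborel. max (- g z) 0)"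

lemma negative_mass_nonneg: "0 \<le> negative_mass"
  unfolding negative_mass_def by (intro integral_nonneg_AE) auto

lemma has_bochner_integral_pos_part: "has_bochner_integral lborel (\<lambda>z. max (g z) 0) (1 + negative_mass)"
proof -
  have "has_bochner_integral lborel (\<lambda>z. max (- g z) 0) negative_mass"
    unfolding negative_mass_def using integrable_g by (intro has_bochner_integral_integrable) auto
  from has_bochner_integral_add[OF has_bochner_integral_g this] show ?thesis
    by (rule has_bochner_integral_cong[THEN iffD1, rotated -1]) auto
qed

text \<open>If \<sigma> is not a slope, the Darboux property keeps all slopes below it. Otherwise
  the level set is bounded below by any point of negative slope, so its infimum is real, and
  monotonicity of \<open>d\<close> does the rest. The slope at \<open>k\<close> itself is left
  open.\<close>

lemma kappa_cases:
  obtains (infinite) "kappa \<psi> \<sigma> = \<infinity>" "\<And>z. d z < \<sigma>"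
  | (finite) k where "kappa \<psi> \<sigma> = ereal k" "\<And>z. z < k \<Longrightarrow> d z < \<sigma>" "\<And>z. k < z \<Longrightarrow> \<sigma> \<le> d z"
proof (cases "\<exists>z. d z = \<sigma>")
  case False
  obtain a where a: "d a < 0" using ex_d_neg by auto
  have "d z < \<sigma>" for z
  proof (rule ccontr)
    assume "\<not> d z < \<sigma>"
    then have "\<sigma> < d z" using False by (metis linorder_neqE)
    moreover have "a \<le> z"
      using monoD[OF mono_d, of z a] a \<sigma>_pos \<open>\<sigma> < d z\<close> by linarith
    ultimately show False
      using deriv_attains_between[OF DERIV_\<psi>, of a z \<sigma>] False a \<sigma>_pos by force
  qed
  then show thesis using infinite False by (simp add: kappa_def)
next
  case True
  let ?K = "{z. d z = \<sigma>}"
  obtain a where a: "d a < 0" using ex_d_neg by auto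
  have "a \<le> z" if "z \<in> ?K" for z
    using monoD[OF mono_d, of z a] a \<sigma>_pos that by force
  then have bdd: "bdd_below ?K" by (rule bdd_belowI)
  show thesis
  proof (rule finite)
    show "kappa \<psi> \<sigma> = ereal (Inf ?K)"
      using True ereal_Inf'[OF bdd] by (auto simp: kappa_def)
    show "d z < \<sigma>" if z: "z < Inf ?K" for z
    proof (rule ccontr)
      assume "\<not> d z < \<sigma>"
      moreover have "z \<notin> ?K" using z cInf_lower[OF _ bdd, of z] by auto
      ultimately have "\<sigma> < d z" by auto
      \<comment> \<open>The whole level set lies to the right of \<open>z\<close>, so by
        monotonicity its slopes would exceed \<sigma>.\<close>
      have "a' \<in> ?K \<Longrightarrow> z \<le> a'" for a'
        using cInf_lower[OF _ bdd, of a'] z by auto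
      with \<open>\<sigma> < d z\<close> True show False
        using monoD[OF mono_d, of z] by force
    qed
    show "\<sigma> \<le> d z" if "Inf ?K < z" for z
    proof -
      have "?K \<noteq> {}" using True by blast
      from cInf_lessD[OF this that] obtain b where "b \<in> ?K" "b < z" by blast
      then show ?thesis using monoD[OF mono_d, of b z] by auto
    qed
  qed
qed

text \<open>In the finite case the dominating function has integral
  \<open>exp (- \<psi> k) / \<sigma>\<close>, half of the boundary term of \<open>tau\<close>; the
  tail integral in \<open>tau\<close> is nonnegative. In the infinite case \<open>g\<close> is
  nonnegative and both sides are 0.\<close>

lemma negative_mass_le_tau: "negative_mass \<le> tau \<psi> \<sigma>"
proof (cases rule: kappa_cases)
  case infinite
  have "max (- g z) 0 = 0" for z
    using infinite(2)[of z] \<sigma>_pos by (auto simp: g_def max_def mult_le_0_iff not_le divide_less_eq)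
  then show ?thesis
    by (simp add: negative_mass_def tau_def infinite(1))
next
  case (finite k)
  \<comment> \<open>A mode cannot lie beyond \<open>k\<close>, where slopes are at least \<sigma>.
    The sign of \<open>d k\<close> opens the way to the half-line integral of
    \<open>d z * exp (- \<psi> z)\<close>.\<close>
  have dk: "0 \<le> d k"
  proof -
    obtain m where m: "d m = 0" using ex_d_eq_0 by auto
    then have "m \<le> k" using finite(3)[of m] \<sigma>_pos by force
    then show ?thesis using monoD[OF mono_d, of m k] m by simp
  qed
  have "negative_mass \<le> (LINT z|lborel. indicator {k..} z *\<^sub>R (d z * exp (- \<psi> z)) / \<sigma>)"
    unfolding negative_mass_def
  proof (rule integral_mono)
    show "integrable lborel (\<lambda>z. max (- g z) 0)" using integrable_g by auto
    show "integrable lborel (\<lambda>z. indicator {k..} z *\<^sub>R (d z * exp (- \<psi> z)) / \<sigma>)"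
      using set_integrable_d_exp_atLeast[OF dk] unfolding set_integrable_def
      by (rule integrable_divide_zero[rotated])
    fix z
    show "max (- g z) 0 \<le> indicator {k..} z *\<^sub>R (d z * exp (- \<psi> z)) / \<sigma>"
    proof (cases "z < k")
      case True
      then show ?thesis using finite(2)[OF True] \<sigma>_pos by (simp add: g_def divide_le_eq)
    next
      case False
      then have "0 \<le> d z" using monoD[OF mono_d, of k z] dk by simp
      then show ?thesis using False \<sigma>_pos by (simp add: g_def algebra_simps)
    qed
  qed
  also have "\<dots> = exp (- \<psi> k) / \<sigma>"
    using set_integral_d_exp_atLeast[OF dk] unfolding set_lebesgue_integral_def by simp
  also have "\<dots> \<le> 2 / \<sigma> * exp (- \<psi> k)"
    using \<sigma>_pos by (simp add: field_simps)
  also have "\<dots> \<le> tau \<psi> \<sigma>"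
  proof -
    have "0 \<le> (LBINT z=ereal k..\<infinity>. exp (- \<psi> z))"
      unfolding interval_integral_to_infinity_eq set_lebesgue_integral_def
      by (intro integral_nonneg_AE) auto
    then show ?thesis by (simp add: tau_def finite(1))
  qed
  finally show ?thesis .
qed

section \<open>Domination of the positive part by the proposal\<close>

lemma \<psi>_half: "\<psi> (z / 2) \<le> (\<psi> z + \<psi> 0) / 2"
  using convex_onD[OF convex, of "1 / 2" z 0] by simp

text \<open>The envelope condition in standard coordinates: the doubled scale of the base density
  becomes \<open>z / 2\<close> and the factor \<open>1 / 2\<close>. Up to \<open>kappa\<close> the
  supremum controls \<open>g\<close>; beyond it \<open>g\<close> is nonpositive and
  \<open>0 \<le> M\<close> suffices.\<close>

lemma pos_part_le:
  assumes M: "ereal (2 * exp (\<psi> 0 / 2)) *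
      (SUP z\<in>{z. ereal z \<le> kappa \<psi> \<sigma>}. ereal (exp (- \<psi> z / 2) * (1 - d z / \<sigma>))) \<le> ereal M"
  shows "max (g z) 0 \<le> M * (exp (- \<psi> (z / 2)) / 2)"
proof -
  \<comment> \<open>The supremum lives in the extended reals; each of its terms is compared with the
    real number \<open>M\<close> separately.\<close>
  have le: "2 * exp (\<psi> 0 / 2) * (exp (- \<psi> z / 2) * (1 - d z / \<sigma>)) \<le> M"
    if "ereal z \<le> kappa \<psi> \<sigma>" for z
  proof -
    have "ereal (2 * exp (\<psi> 0 / 2)) * ereal (exp (- \<psi> z / 2) * (1 - d z / \<sigma>))
      \<le> ereal (2 * exp (\<psi> 0 / 2)) *
        (SUP z\<in>{z. ereal z \<le> kappa \<psi> \<sigma>}. ereal (exp (- \<psi> z / 2) * (1 - d z / \<sigma>)))"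
      using that by (intro ereal_mult_left_mono SUP_upper) auto
    also note M
    finally show ?thesis by simp
  qed
  \<comment> \<open>A mode lies at or below \<open>kappa\<close> and its term in the supremum is
    positive.\<close>
  have M0: "0 \<le> M"
  proof -
    obtain m where m: "d m = 0" using ex_d_eq_0 by auto
    have "ereal m \<le> kappa \<psi> \<sigma>"
      by (cases rule: kappa_cases) (use m \<sigma>_pos in \<open>force simp: not_le[symmetric]\<close>)+
    from le[OF this] show ?thesis
      using m by (auto elim: order_trans[rotated])
  qed
  show ?thesis
  proof (cases "d z \<le> \<sigma>")
    case False
    then have "g z \<le> 0" using \<sigma>_pos by (simp add: g_def mult_le_0_iff field_simps)
    then show ?thesis using M0 by simp
  next
    case True
    show ?thesis
    proof (cases "ereal z \<le> kappa \<psi> \<sigma>")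
      \<comment> \<open>Beyond \<open>kappa\<close> the slope may stay equal to \<sigma> on an
        interval; there \<open>g\<close> vanishes.\<close>
      case False
      then have "g z \<le> 0"
        by (cases rule: kappa_cases) (use \<sigma>_pos in \<open>auto simp: g_def mult_le_0_iff field_simps\<close>)
      then show ?thesis using M0 by simp
    next
      case z: True
      have "1 - d z / \<sigma> \<ge> 0" using True \<sigma>_pos by simp
      then have "0 \<le> g z" by (simp add: g_def)
      have "g z = exp (- \<psi> z / 2) * exp (- \<psi> z / 2) * (1 - d z / \<sigma>)"
        by (simp add: g_def exp_add[symmetric])
      \<comment> \<open>Midpoint convexity between \<open>z\<close> and 0 trades one copy of
        \<open>exp (- \<psi> z / 2)\<close> for the proposal; the other copy is kept for the
        supremum.\<close>
      also have "\<dots> \<le> exp (- \<psi> z / 2) * exp (\<psi> 0 / 2 - \<psi> (z / 2)) * (1 - d z / \<sigma>)"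
        using \<psi>_half[of z] \<open>1 - d z / \<sigma> \<ge> 0\<close>
        by (intro mult_right_mono mult_left_mono) (auto simp: field_simps)
      also have "\<dots> = 2 * exp (\<psi> 0 / 2) * (exp (- \<psi> z / 2) * (1 - d z / \<sigma>)) * (exp (- \<psi> (z / 2)) / 2)"
      proof -
        have "exp (\<psi> 0 / 2 - \<psi> (z / 2)) = exp (\<psi> 0 / 2) * exp (- \<psi> (z / 2))"
          by (simp add: exp_add[symmetric])
        then show ?thesis by (simp only:) (simp add: mult_ac)
      qed
      also have "\<dots> \<le> M * (exp (- \<psi> (z / 2)) / 2)"
        by (intro mult_right_mono le z) auto
      finally show ?thesis using \<open>0 \<le> g z\<close> by simp
    qed
  qed
qed

lemma has_bochner_integral_signed_kernel: "has_bochner_integral lborel (\<lambda>y. signed_kernel \<psi> \<sigma> y x) 1"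
  unfolding signed_kernel_eq
  by (rule has_bochner_integral_location_scale[OF has_bochner_integral_g \<sigma>_pos])

lemma rejection_sampler:
  assumes M: "ereal (2 * exp (\<psi> 0 / 2)) *
      (SUP z\<in>{z. ereal z \<le> kappa \<psi> \<sigma>}. ereal (exp (- \<psi> z / 2) * (1 - d z / \<sigma>))) \<le> ereal M"
  shows "rejection_sampler (\<lambda>y. signed_kernel \<psi> \<sigma> y x) (\<lambda>y. base_density \<psi> \<sigma> y x) M (1 + negative_mass)"
proof
  have max_eq: "max (signed_kernel \<psi> \<sigma> y x) 0 = max (g ((y - (x + 1)) / \<sigma>)) 0 / \<sigma>" for y
    using \<sigma>_pos by (auto simp: signed_kernel_eq max_def divide_le_0_iff zero_le_divide_iff)
  show "(\<lambda>y. signed_kernel \<psi> \<sigma> y x) \<in> borel_measurable borel"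
    unfolding signed_kernel_eq by measurable
  show "0 \<le> base_density \<psi> \<sigma> y x" for y
    using \<sigma>_pos by (simp add: base_density_eq)
  show "max (signed_kernel \<psi> \<sigma> y x) 0 \<le> M * base_density \<psi> \<sigma> y x" for y
    using divide_right_mono[OF pos_part_le[OF M, of "(y - (x + 1)) / \<sigma>"], of \<sigma>] \<sigma>_pos
    by (simp add: max_eq base_density_eq mult.commute)
  show "has_bochner_integral lborel (\<lambda>y. base_density \<psi> \<sigma> y x) 1"
    unfolding base_density_eq
    by (rule has_bochner_integral_location_scale[OF integral_1]) (use \<sigma>_pos in simp)
  show "has_bochner_integral lborel (\<lambda>y. max (signed_kernel \<psi> \<sigma> y x) 0) (1 + negative_mass)"
    unfolding max_eq by (rule has_bochner_integral_location_scale[OF has_bochner_integral_pos_part \<sigma>_pos])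
  show "0 < 1 + negative_mass"
    using negative_mass_nonneg by simp
qed

section \<open>Averaging the signed kernel over the source\<close>

lemma integral_source_signed_kernel:
  "(LINT x|lborel. source_density x \<theta> * signed_kernel \<psi> \<sigma> y x) = target_density \<psi> \<sigma> y \<theta>"
proof -
  define a where "a = \<theta> - 1"
  \<comment> \<open>At \<open>x = a\<close> the exponential factor is 1 and
    \<open>x + 1 = \<theta>\<close>, so the lower boundary term is exactly the target
    density.\<close>
  let ?F = "\<lambda>x. - (exp (- (x - a)) * (exp (- \<psi> ((y - (x + 1)) / \<sigma>)) / \<sigma>))"
  let ?f = "\<lambda>x. exp (- (x - a)) * signed_kernel \<psi> \<sigma> y x"
  have "(LINT x|lborel. source_density x \<theta> * signed_kernel \<psi> \<sigma> y x) = (LINT x:{a..}|lborel. ?f x)"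
    unfolding set_lebesgue_integral_def source_density_def
    by (intro Bochner_Integration.integral_cong) (auto simp: a_def split: split_indicator)
  also have "\<dots> = - ?F a"
  proof (rule set_integral_FTC_atLeast[where F = ?F])
    show "(?F has_real_derivative ?f x) (at x)" for x
      unfolding signed_kernel_eq g_def using \<sigma>_pos
      by (auto intro!: derivative_eq_intros simp: field_simps)
    have "(y - 1) / \<sigma> + (- 1 / \<sigma>) * x = (y - (x + 1)) / \<sigma>" for x
      by (simp add: diff_divide_distrib add_divide_distrib)
    then have "integrable lborel (\<lambda>x. signed_kernel \<psi> \<sigma> y x)"
      using lborel_integrable_real_affine[OF integrable_g, of "- 1 / \<sigma>" "(y - 1) / \<sigma>"] \<sigma>_pos
      by (simp only:) (simp add: signed_kernel_eq)
    then show "set_integrable lborel {a..} ?f"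
      unfolding set_integrable_def
      by (rule Bochner_Integration.integrable_bound)
         (auto simp: signed_kernel_eq abs_mult intro!: AE_I2 divide_right_mono mult_left_le_one_le split: split_indicator)
    \<comment> \<open>A lower bound on \<psi> bounds \<open>?F\<close> by a multiple of
      \<open>exp (- (x - a))\<close>, which removes the boundary term at infinity.\<close>
    obtain m where m: "\<And>x. \<psi> m \<le> \<psi> x" using \<psi>_bounded_below by auto
    have "((\<lambda>x. exp (- (x - a)) * (exp (- \<psi> m) / \<sigma>)) \<longlongrightarrow> 0) at_top"
      by real_asymp
    then show "(?F \<longlongrightarrow> 0) at_top"
      by (rule Lim_null_comparison[rotated])
         (use m \<sigma>_pos in \<open>auto intro!: always_eventually simp: abs_mult divide_right_mono\<close>)
  qed
  also have "- ?F a = target_density \<psi> \<sigma> y \<theta>"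
    by (simp add: a_def target_density_def)
  finally show ?thesis .
qed

lemma has_bochner_integral_target_density: "has_bochner_integral lborel (\<lambda>y. target_density \<psi> \<sigma> y \<theta>) 1"
  using has_bochner_integral_location_scale[OF integral_1 \<sigma>_pos, of \<theta>]
  by (simp add: target_density_def)

text \<open>Fubini applies because the \<open>L1\<close> norm of the kernel in \<open>y\<close>
  equals that of \<open>g\<close> for every \<open>x\<close>, and the source is a probability
  measure.\<close>

lemma integral_integral_signed_kernel:
  fixes A :: "real set" and \<theta> :: real
  defines "\<mu> \<equiv> density lborel (\<lambda>x. ennreal (source_density x \<theta>))"
  assumes A [measurable]: "A \<in> sets borel"
  shows "(LINT x|\<mu>. (LINT y:A|lborel. signed_kernel \<psi> \<sigma> y x)) = (LINT y:A|lborel. target_density \<psi> \<sigma> y \<theta>)"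
    and "integrable \<mu> (\<lambda>x. (LINT y:A|lborel. signed_kernel \<psi> \<sigma> y x))"
proof -
  have [measurable_cong]: "sets \<mu> = sets borel" by (simp add: \<mu>_def)
  interpret prob_space \<mu> unfolding \<mu>_def by (rule prob_space_source_density)
  interpret pair_sigma_finite \<mu> lborel ..
  let ?f = "\<lambda>x y. indicator A y * signed_kernel \<psi> \<sigma> y x"
  have int_S: "integrable lborel (\<lambda>y. signed_kernel \<psi> \<sigma> y x)" for x
    using has_bochner_integral_signed_kernel by (rule integrable.intros)
  have int_f: "integrable lborel (?f x)" for x
    using integrable_mult_indicator[OF _ int_S, of A x] by simp
  have abs_S: "(LINT y|lborel. \<bar>signed_kernel \<psi> \<sigma> y x\<bar>) = (LINT z|lborel. \<bar>g z\<bar>)" for x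
  proof -
    have "has_bochner_integral lborel (\<lambda>z. \<bar>g z\<bar>) (LINT z|lborel. \<bar>g z\<bar>)"
      using integrable_g by (intro has_bochner_integral_integrable) auto
    from has_bochner_integral_location_scale[OF this \<sigma>_pos, of "x + 1"] show ?thesis
      using \<sigma>_pos by (auto simp: signed_kernel_eq abs_divide dest: has_bochner_integral_integral_eq)
  qed
  have int: "integrable (\<mu> \<Otimes>\<^sub>M lborel) (case_prod ?f)"
  proof (rule Fubini_integrable)
    show "integrable \<mu> (\<lambda>x. LINT y|lborel. norm (case_prod ?f (x, y)))"
    proof (rule integrable_const_bound[where B = "LINT z|lborel. \<bar>g z\<bar>"])
      have "(LINT y|lborel. \<bar>?f x y\<bar>) \<le> (LINT z|lborel. \<bar>g z\<bar>)" for x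
        unfolding abs_S[of x, symmetric]
        by (rule integral_mono) (use int_f int_S in \<open>auto split: split_indicator\<close>)
      then show "AE x in \<mu>. norm (LINT y|lborel. norm (case_prod ?f (x, y))) \<le> (LINT z|lborel. \<bar>g z\<bar>)"
        by simp
    qed (simp, measurable)
  qed (use int_f in \<open>auto intro: measurable_compose\<close>)
  show "integrable \<mu> (\<lambda>x. (LINT y:A|lborel. signed_kernel \<psi> \<sigma> y x))"
    using integrable_fst'[OF int] by (simp add: set_lebesgue_integral_def)
  have inner: "(LINT x|\<mu>. ?f x y) = indicator A y * target_density \<psi> \<sigma> y \<theta>" for y
  proof -
    have "(LINT x|\<mu>. signed_kernel \<psi> \<sigma> y x) = (LINT x|lborel. source_density x \<theta> * signed_kernel \<psi> \<sigma> y x)"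
      unfolding \<mu>_def
      by (rule integral_real_density) (auto simp: source_density_def signed_kernel_eq)
    then show ?thesis by (simp add: integral_source_signed_kernel)
  qed
  have "(LINT x|\<mu>. (LINT y:A|lborel. signed_kernel \<psi> \<sigma> y x)) = (LINT y|lborel. LINT x|\<mu>. ?f x y)"
    using Fubini_integral[OF int] by (simp add: set_lebesgue_integral_def)
  also have "\<dots> = (LINT y:A|lborel. target_density \<psi> \<sigma> y \<theta>)"
    by (simp only: inner) (simp add: set_lebesgue_integral_def)
  finally show "(LINT x|\<mu>. (LINT y:A|lborel. signed_kernel \<psi> \<sigma> y x)) = (LINT y:A|lborel. target_density \<psi> \<sigma> y \<theta>)" .
qed

section \<open>Total variation bound for the sampler with random input\<close>

lemma measure_target:
  assumes A: "A \<in> sets borel"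
  shows "measure (density lborel (\<lambda>y. ennreal (target_density \<psi> \<sigma> y \<theta>))) A
    = (LINT y:A|lborel. target_density \<psi> \<sigma> y \<theta>)"
proof -
  have nonneg: "0 \<le> target_density \<psi> \<sigma> y \<theta>" for y
    using \<sigma>_pos by (simp add: target_density_def)
  have "integrable lborel (\<lambda>y. indicator A y *\<^sub>R target_density \<psi> \<sigma> y \<theta>)"
    using A integrable.intros[OF has_bochner_integral_target_density] by (intro integrable_mult_indicator) auto
  then have "(\<integral>\<^sup>+y. ennreal (indicator A y *\<^sub>R target_density \<psi> \<sigma> y \<theta>) \<partial>lborel)
      = ennreal (LINT y:A|lborel. target_density \<psi> \<sigma> y \<theta>)"
    unfolding set_lebesgue_integral_def
    by (rule nn_integral_eq_integral) (use nonneg in \<open>auto split: split_indicator\<close>)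
  moreover have "emeasure (density lborel (\<lambda>y. ennreal (target_density \<psi> \<sigma> y \<theta>))) A
      = (\<integral>\<^sup>+y. ennreal (indicator A y *\<^sub>R target_density \<psi> \<sigma> y \<theta>) \<partial>lborel)"
    using A by (subst emeasure_density)
      (auto simp: target_density_def intro!: nn_integral_cong split: split_indicator)
  moreover have "0 \<le> (LINT y:A|lborel. target_density \<psi> \<sigma> y \<theta>)"
    unfolding set_lebesgue_integral_def using nonneg
    by (intro integral_nonneg_AE) (auto split: split_indicator)
  ultimately show ?thesis by (simp add: measure_def)
qed

text \<open>The error bound on an event is uniform in the input, so it survives averaging over the
  source. The second conclusion makes the base of the power nonnegative.\<close>

lemma tv_dist_rk_le:
  fixes N :: nat and M y0 \<theta> :: real
  assumes M: "ereal (2 * exp (\<psi> 0 / 2)) *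
      (SUP z\<in>{z. ereal z \<le> kappa \<psi> \<sigma>}. ereal (exp (- \<psi> z / 2) * (1 - d z / \<sigma>))) \<le> ereal M"
  shows "tv_dist
      (density lborel (\<lambda>x. ennreal (source_density x \<theta>)) \<bind>
        (\<lambda>x. rk (signed_kernel \<psi> \<sigma>) (base_density \<psi> \<sigma>) x N M y0))
      (density lborel (\<lambda>y. ennreal (target_density \<psi> \<sigma> y \<theta>)))
    \<le> (1 - (1 + negative_mass) / M) ^ (N + 1) + negative_mass"
    and "1 + negative_mass \<le> M"
proof -
  interpret rs: rejection_sampler "\<lambda>y. signed_kernel \<psi> \<sigma> y x" "\<lambda>y. base_density \<psi> \<sigma> y x" M "1 + negative_mass" for x
    by (rule rejection_sampler[OF M])
  show "1 + negative_mass \<le> M" by (rule rs.q_le_M)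
  define \<mu> where "\<mu> = density lborel (\<lambda>x. ennreal (source_density x \<theta>))"
  have sets_\<mu> [measurable_cong]: "sets \<mu> = sets borel" by (simp add: \<mu>_def)
  interpret prob_space \<mu> unfolding \<mu>_def by (rule prob_space_source_density)
  define K where "K x = rk (signed_kernel \<psi> \<sigma>) (base_density \<psi> \<sigma>) x N M y0" for x
  define R where "R x A = rs.output_prob x y0 (N + 1) A" for x A
  have K: "prob_space (K x)" "sets (K x) = sets borel"
      "A \<in> sets borel \<Longrightarrow> emeasure (K x) A = ennreal (R x A)" for x A
    using rejection_loop[where S = "signed_kernel \<psi> \<sigma>" and P = "base_density \<psi> \<sigma>" and x = x
        and ?y0.0 = y0 and n = "N + 1", OF rejection_sampler[OF M]]
    unfolding K_def R_def rk_def by blast+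
  \<comment> \<open>Through the closed form, dependence on \<open>x\<close> is only through
    integrals of the jointly measurable kernel; this makes \<open>K\<close> a measurable
    kernel.\<close>
  have R_measurable [measurable]: "(\<lambda>x. R x A) \<in> borel_measurable borel" if [measurable]: "A \<in> sets borel" for A
    unfolding R_def rs.output_prob_def rs.accepted_def set_lebesgue_integral_def by measurable
  have R_nonneg: "0 \<le> R x A" for x A
    unfolding R_def by (rule rs.output_prob_nonneg)
  have R_le_1: "R x A \<le> 1" if "A \<in> sets borel" for x A
    using prob_space.emeasure_le_1[OF K(1), of x A] K(3)[OF that] R_nonneg by simp
  have K_kernel: "K \<in> measurable \<mu> (subprob_algebra borel)"
  proof (rule measurable_subprob_algebra)
    fix A :: "real set" assume [measurable]: "A \<in> sets borel"
    show "(\<lambda>x. emeasure (K x) A) \<in> borel_measurable \<mu>"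
      unfolding K(3)[OF \<open>A \<in> sets borel\<close>] by measurable
  qed (auto simp: K intro: prob_space_imp_subprob_space)
  have sets_bind: "sets (\<mu> \<bind> K) = sets borel"
    by (rule sets_bind_measurable[OF K_kernel not_empty])
  show "tv_dist
      (density lborel (\<lambda>x. ennreal (source_density x \<theta>)) \<bind>
        (\<lambda>x. rk (signed_kernel \<psi> \<sigma>) (base_density \<psi> \<sigma>) x N M y0))
      (density lborel (\<lambda>y. ennreal (target_density \<psi> \<sigma> y \<theta>)))
    \<le> (1 - (1 + negative_mass) / M) ^ (N + 1) + negative_mass"
    unfolding tv_dist_def \<mu>_def[symmetric] K_def[symmetric]
  proof (rule cSUP_least)
    show "sets (\<mu> \<bind> K) \<noteq> {}" by auto
    fix A assume "A \<in> sets (\<mu> \<bind> K)"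
    then have A: "A \<in> sets borel" by (simp add: sets_bind)
    note [measurable] = A
    let ?T = "\<lambda>x. (LINT y:A|lborel. signed_kernel \<psi> \<sigma> y x)"
    have int_R: "integrable \<mu> (\<lambda>x. R x A)"
      by (rule integrable_const_bound[where B = 1]) (use R_nonneg R_le_1[OF A] in auto)
    have int_T: "integrable \<mu> ?T"
      unfolding \<mu>_def by (rule integral_integral_signed_kernel(2)[OF A])
    have "emeasure (\<mu> \<bind> K) A = ennreal (LINT x|\<mu>. R x A)"
      using int_R R_nonneg
      by (simp add: emeasure_bind[OF not_empty K_kernel A] K(3)[OF A] nn_integral_eq_integral)
    then have "measure (\<mu> \<bind> K) A = (LINT x|\<mu>. R x A)"
      by (simp add: measure_def R_nonneg)
    then have "\<bar>measure (\<mu> \<bind> K) A - measure (density lborel (\<lambda>y. ennreal (target_density \<psi> \<sigma> y \<theta>))) A\<bar>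
        = \<bar>LINT x|\<mu>. R x A - ?T x\<bar>"
      using int_R int_T integral_integral_signed_kernel(1)[OF A, of \<theta>]
      by (simp add: measure_target[OF A] \<mu>_def)
    also have "\<dots> \<le> (LINT x|\<mu>. \<bar>R x A - ?T x\<bar>)"
      by (rule integral_abs_bound)
    also have "\<dots> \<le> (LINT x|\<mu>. (1 - (1 + negative_mass) / M) ^ (N + 1) + negative_mass)"
    proof (rule integral_mono)
      show "\<bar>R x A - ?T x\<bar> \<le> (1 - (1 + negative_mass) / M) ^ (N + 1) + negative_mass" for x
        using rs.output_prob_error[OF has_bochner_integral_signed_kernel A, of x y0 "N + 1"]
        unfolding R_def by simp
    qed (use int_R int_T in auto)
    also have "\<dots> = (1 - (1 + negative_mass) / M) ^ (N + 1) + negative_mass"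
      using prob_space by simp
    finally show "\<bar>measure (\<mu> \<bind> K) A - measure (density lborel (\<lambda>y. ennreal (target_density \<psi> \<sigma> y \<theta>))) A\<bar>
      \<le> (1 - (1 + negative_mass) / M) ^ (N + 1) + negative_mass" .
  qed
qed

end

section \<open>From the geometric rejection probability to the exponential bound\<close>

lemma rejection_power_le:
  fixes M n t :: real and N :: nat
  assumes "0 \<le> n" "1 + n \<le> M" "0 \<le> t"
  shows "(1 - (1 + n) / M) ^ (N + 1) \<le> 2 * exp (- (real N / M) * (1 - t))"
proof -
  have M: "0 < M" using assms by linarith
  have r: "0 \<le> 1 - (1 + n) / M" "1 - (1 + n) / M \<le> 1" using assms M by auto
  \<comment> \<open>Each round accepts with probability at least \<open>1 / M\<close>, since the
    positive part has mass at least 1.\<close>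
  have "1 - (1 + n) / M \<le> 1 + (- 1 / M)"
    using \<open>0 \<le> n\<close> M by (simp add: divide_right_mono)
  also have "\<dots> \<le> exp (- 1 / M)" by (rule exp_ge_add_one_self)
  finally have "(1 - (1 + n) / M) ^ N \<le> exp (- 1 / M) ^ N"
    using r by (intro power_mono)
  \<comment> \<open>There are \<open>N + 1\<close> rounds while the claimed exponent has
    \<open>N\<close>; one factor, at most 1, is discarded.\<close>
  moreover have "(1 - (1 + n) / M) ^ (N + 1) \<le> (1 - (1 + n) / M) ^ N"
    using r by (intro power_decreasing) auto
  moreover have "exp (- 1 / M) ^ N = exp (- (real N / M))"
    by (simp add: exp_of_nat_mult[symmetric])
  \<comment> \<open>Slowing the rate from 1 to \<open>1 - t\<close> only enlarges the bound, also
    when \<open>t\<close> exceeds 1.\<close>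
  moreover have "exp (- (real N / M)) \<le> exp (- (real N / M) * (1 - t))"
  proof -
    have "0 \<le> real N / M * t" using M \<open>0 \<le> t\<close> by simp
    then show ?thesis by (simp only: exp_le_cancel_iff) (simp add: right_diff_distrib)
  qed
  moreover have "0 \<le> exp (- (real N / M) * (1 - t))" by simp
  ultimately show ?thesis by linarith
qed

theorem theorem2:
  fixes \<psi> :: "real \<Rightarrow> real" and \<sigma> \<theta> y0 M :: real and N :: nat
  assumes "convex_on UNIV \<psi>" and "\<psi> differentiable_on UNIV"
    and "has_bochner_integral lborel (\<lambda>z. exp (- \<psi> z)) 1"
    and "has_bochner_integral lborel (\<lambda>z. z * exp (- \<psi> z)) 0"
    and "has_bochner_integral lborel (\<lambda>z. z\<^sup>2 * exp (- \<psi> z)) 1"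
    and "\<sigma> > 0" and "N \<ge> 1"
    and "ereal M \<ge> ereal (2 * exp (\<psi> 0 / 2)) *
           (SUP z\<in>{z. ereal z \<le> kappa \<psi> \<sigma>}. ereal (exp (- \<psi> z / 2) * (1 - deriv \<psi> z / \<sigma>)))"
  shows "tv_dist
           (density lborel (\<lambda>x. ennreal (source_density x \<theta>)) \<bind>
             (\<lambda>x. rk (signed_kernel \<psi> \<sigma>) (base_density \<psi> \<sigma>) x N M y0))
           (density lborel (\<lambda>y. ennreal (target_density \<psi> \<sigma> y \<theta>)))
         \<le> 2 * exp (- (real N / M) * (1 - tau \<psi> \<sigma>)) + tau \<psi> \<sigma>"
proof -
  interpret exponential_location_model \<psi> \<sigma>
    using assms by unfold_locales auto
  note bound = tv_dist_rk_le(1)[OF assms(8), of \<theta> N y0] tv_dist_rk_le(2)[OF assms(8)]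
  \<comment> \<open>The chain \<open>0 \<le> negative_mass \<le> tau \<psi> \<sigma>\<close>
    supplies the sign condition for \<open>rejection_power_le\<close> and bounds the additive
    term.\<close>
  show ?thesis
    using bound rejection_power_le[of negative_mass M "tau \<psi> \<sigma>" N]
      negative_mass_nonneg negative_mass_le_tau
    by linarith
qed

end
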